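(* Let $e_1,e_2$ be StacKAT programs over a finite set of fields $F$ and a finite set of values $V\subseteq\mathbb N$. Then $\overline{\mathsf{traces}}_{\alpha_1}^{\alpha_2}(e_1)=\overline{\mathsf{traces}}_{\alpha_1}^{\alpha_2}(e_2)$ for all headers $\alpha_1,\alpha_2\in F\to V$ if and only if $\llbracket e_1\rrbracket=\llbracket e_2\rrbracket$.
   Context: Syntax and semantics. A header is a function $h:F\to V$; a stack is a finite list over $V$ (head of the list = top of the stack); a packet is a pair $\langle h,s\rangle$ of a header and a stack; $\mathsf{Pk}$ is the set of packets. StacKAT programs are given by $e::=0\mid 1\mid e_1+e_2\mid e_1\cdot e_2\mid e^*\mid f{=}v\mid f{\leftarrow}v\mid \mathsf{push}(v)\mid\mathsf{pop}(v)$ with $f\in F$, $v\in V$. The semantics $\llbracket e\rrbracket\subseteq \mathsf{Pk}\times\mathsf{Pk}$ is: $\llbracket 0\rrbracket=\emptyset$; $\llbracket 1\rrbracket$ is the identity relation; $\llbracket e_1+e_2\rrbracket=\llbracket e_1\rrbracket\cup\llbracket e_2\rrbracket$; $\llbracket e_1\cdot e_2\rrbracket=\{(p,p'')\mid \exists p',\ (p,p')\in\llbracket e_1\rrbracket,(p',p'')\in\llbracket e_2\rrbracket\}$; $\llbracket e^*\rrbracket=\bigcup_{i\ge0}\llbracket e^i\rrbracket$ with $e^0=1$, $e^{n+1}=e\cdot e^n$; $\llbracket f{=}v\rrbracket=\{(\langle h,s\rangle,\langle h,s\rangle)\mid h(f)=v\}$; $\llbracket f{\leftarrow}v\rrbracket=\{(\langle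 h,s\rangle,\langle h[f\leftarrow v],s\rangle)\}$; $\llbracket\mathsf{push}(v)\rrbracket=\{(\langle h,s\rangle,\langle h,v::s\rangle)\}$; $\llbracket\mathsf{pop}(v)\rrbracket=\{(\langle h,v::s\rangle,\langle h,s\rangle)\}$. Trace languages. Let $\Sigma=\{\mathsf{push}(v),\mathsf{pop}(v)\mid v\in V\}$. For headers $\alpha,\alpha'$ define $\mathsf{traces}_\alpha^{\alpha'}(e)\subseteq\Sigma^*$ by recursion: for $0$ it is $\emptyset$; for $1$ it is $\{\epsilon\}$ if $\alpha=\alpha'$, else $\emptyset$; for $f{=}v$ it is $\{\epsilon\}$ if $\alpha=\alpha'$ and $\alpha(f)=v$, else $\emptyset$; for $f{\leftarrow}v$ it is $\{\epsilon\}$ if $\alpha'=\alpha[f\leftarrow v]$, else $\emptyset$; for $\mathsf{push}(v)$ (resp. $\mathsf{pop}(v)$) it is $\{\mathsf{push}(v)\}$ (resp. $\{\mathsf{pop}(v)\}$) if $\alpha=\alpha'$, else $\emptyset$; $\mathsf{traces}_\alpha^{\alpha'}(e_1+e_2)=\mathsf{traces}_\alpha^{\alpha'}(e_1)\cup\mathsf{traces}_\alpha^{\alpha'}(e_2)$; $\mathsf{traces}_\alpha^{\alpha'}(e_1\cdot e_2)=\{s_1s_2\mid s_1\in\mathsf{traces}_\alpha^\beta(e_1),\ s_2\in\mathsf{traces}_\beta^{\alpha'}(e_2),\ \beta\in F\to V\}$; $\mathsf{traces}_\alpha^{\alpha'}(e^* )=\bigcup_{n}\mathsf{traces}_\alpha^{\alpha'}(e^n)$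 with $e^0=1$, $e^{n+1}=e^n\cdot e$. Canonicalization. For $L\subseteq\Sigma^*$, $\mathsf{pushpop}(L)$ is the least language containing $L$ such that $x\cdot\mathsf{push}(v)\cdot\mathsf{pop}(v)\cdot y\in\mathsf{pushpop}(L)$ implies $x\cdot y\in\mathsf{pushpop}(L)$. The partial function $\mathsf{zip}$, defined exactly on words consisting of pops followed by pushes, is: $\mathsf{zip}(\epsilon)=\epsilon$; $\mathsf{zip}(x\cdot\mathsf{pop}(v)\cdot\mathsf{push}(w)\cdot y)=(\mathsf{pop}(v),\mathsf{push}(w))\cdot\mathsf{zip}(x\cdot y)$; $\mathsf{zip}(x\cdot\mathsf{pop}(v))=(\mathsf{pop}(v),\mathsf{done})\cdot\mathsf{zip}(x)$; $\mathsf{zip}(\mathsf{push}(v)\cdot y)=(\mathsf{done},\mathsf{push}(v))\cdot\mathsf{zip}(y)$, where $x$ ranges over words of pops, $y$ over words of pushes, and $\mathsf{done}$ is a placeholder symbol. For a language, $\mathsf{zip}(L)=\{\mathsf{zip}(x)\mid x\in L,\ \mathsf{zip}(x)\text{ defined}\}$. Let $A=\{(\mathsf{pop}(v),\mathsf{push}(v))\mid v\in V\}$. Then $$\overline{\mathsf{traces}}_{\alpha_1}^{\alpha_2}(e)=A^*\cdot\mathsf{zip}\bigl(\mathsf{pushpop}(\mathsf{traces}_{\alpha_1}^{\alpha_2}(e))\bigr).$$ *)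

theory Defs
  imports "HOL-Library.FuncSet"
begin

text \<open>
  The finite sets \<open>F\<close> of fields and \<open>V\<close> of values are explicit carrier sets. The set functions
  of the datatype collect the fields and values occurring in an expression.
\<close>

datatype (fields_of: 'f, vals_of: 'v) prog =
    Zero
  | One
  | Plus "('f, 'v) prog" "('f, 'v) prog"
  | Seq "('f, 'v) prog" "('f, 'v) prog"
  | Star "('f, 'v) prog"
  | Test 'f 'v
  | Assign 'f 'v
  | PushP 'v
  | PopP 'v

definition programs :: "'f set \<Rightarrow> 'v set \<Rightarrow> ('f, 'v) prog set" where
  "programs F V = {e. fields_of e \<subseteq> F \<and> vals_of e \<subseteq> V}"

text \<open>
  Headers are extensional (\<open>undefined\<close> outside \<open>F\<close>), so that equality of headers is equality of
  functions on \<open>F\<close>.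
\<close>

definition headers :: "'f set \<Rightarrow> 'v set \<Rightarrow> ('f \<Rightarrow> 'v) set" where
  "headers F V = (F \<rightarrow>\<^sub>E V)"

type_synonym ('f, 'v) packet = "('f \<Rightarrow> 'v) \<times> 'v list"

definition packets :: "'f set \<Rightarrow> 'v set \<Rightarrow> ('f, 'v) packet set" where
  "packets F V = headers F V \<times> lists V"

text \<open>
  The two iterations unfold on different sides: \<open>lpow\<close> is used in the semantics, \<open>rpow\<close> in the
  trace languages.
\<close>

primrec lpow :: "('f, 'v) prog \<Rightarrow> nat \<Rightarrow> ('f, 'v) prog" where
  "lpow e 0 = One"
| "lpow e (Suc n) = Seq e (lpow e n)"

primrec rpow :: "('f, 'v) prog \<Rightarrow> nat \<Rightarrow> ('f, 'v) prog" where
  "rpow e 0 = One"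
| "rpow e (Suc n) = Seq (rpow e n) e"

text \<open>Used only to justify termination of the recursions through \<open>lpow\<close> and \<open>rpow\<close> below.\<close>

primrec star_height :: "('f, 'v) prog \<Rightarrow> nat" where
  "star_height Zero = 0"
| "star_height One = 0"
| "star_height (Plus e1 e2) = max (star_height e1) (star_height e2)"
| "star_height (Seq e1 e2) = max (star_height e1) (star_height e2)"
| "star_height (Star e) = Suc (star_height e)"
| "star_height (Test f v) = 0"
| "star_height (Assign f v) = 0"
| "star_height (PushP v) = 0"
| "star_height (PopP v) = 0"

lemma star_height_lpow: "star_height (lpow e n) \<le> star_height e"
  by (induction n) auto

lemma star_height_rpow: "star_height (rpow e n) \<le> star_height e"
  by (induction n) auto

function sem :: "'f set \<Rightarrow> 'v set \<Rightarrow> ('f, 'v) prog \<Rightarrow> ('f, 'v) packet rel" where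
  "sem F V Zero = {}"
| "sem F V One = Id_on (packets F V)"
| "sem F V (Plus e1 e2) = sem F V e1 \<union> sem F V e2"
| "sem F V (Seq e1 e2) = sem F V e1 O sem F V e2"
| "sem F V (Star e) = (\<Union>i. sem F V (lpow e i))"
| "sem F V (Test f v) = {((h, s), (h, s)) | h s. (h, s) \<in> packets F V \<and> h f = v}"
| "sem F V (Assign f v) = {((h, s), (h(f := v), s)) | h s. (h, s) \<in> packets F V}"
| "sem F V (PushP v) = {((h, s), (h, v # s)) | h s. (h, s) \<in> packets F V}"
| "sem F V (PopP v) = {((h, v # s), (h, s)) | h s. (h, s) \<in> packets F V}"
  by pat_completeness auto
termination
  by (relation "measures [\<lambda>(F, V, e). star_height e, \<lambda>(F, V, e). size e]")
    (auto simp: less_Suc_eq_le star_height_lpow less_max_iff_disj)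

lemma headers_update: "h \<in> headers F V \<Longrightarrow> f \<in> F \<Longrightarrow> v \<in> V \<Longrightarrow> h(f := v) \<in> headers F V"
  unfolding headers_def by (metis PiE_fun_upd insert_absorb)

lemma sem_subset_packets:
  "e \<in> programs F V \<Longrightarrow> sem F V e \<subseteq> packets F V \<times> packets F V"
proof (induction F V e rule: sem.induct)
  case (4 F V e1 e2)
  then have "sem F V e1 \<subseteq> packets F V \<times> packets F V" "sem F V e2 \<subseteq> packets F V \<times> packets F V"
    by (auto simp: programs_def)
  then show ?case
    by auto
next
  case (5 F V e)
  have "lpow e i \<in> programs F V" for i
    using 5(2) by (induction i) (auto simp: programs_def)
  then have "sem F V (lpow e i) \<subseteq> packets F V \<times> packets F V" for i
    using 5(1) by blast
  then show ?case
    by (simp add: UN_subset_iff)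
qed (auto simp: programs_def packets_def headers_update)

datatype 'v stackop = Push 'v | Pop 'v

function traces ::
  "'f set \<Rightarrow> 'v set \<Rightarrow> ('f, 'v) prog \<Rightarrow> ('f \<Rightarrow> 'v) \<Rightarrow> ('f \<Rightarrow> 'v) \<Rightarrow> 'v stackop list set" where
  "traces F V Zero \<alpha> \<alpha>' = {}"
| "traces F V One \<alpha> \<alpha>' = (if \<alpha> = \<alpha>' then {[]} else {})"
| "traces F V (Plus e1 e2) \<alpha> \<alpha>' = traces F V e1 \<alpha> \<alpha>' \<union> traces F V e2 \<alpha> \<alpha>'"
| "traces F V (Seq e1 e2) \<alpha> \<alpha>' =
     (\<Union>\<beta>\<in>headers F V. {s1 @ s2 | s1 s2. s1 \<in> traces F V e1 \<alpha> \<beta> \<and> s2 \<in> traces F V e2 \<beta> \<alpha>'})"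
| "traces F V (Star e) \<alpha> \<alpha>' = (\<Union>n. traces F V (rpow e n) \<alpha> \<alpha>')"
| "traces F V (Test f v) \<alpha> \<alpha>' = (if \<alpha> = \<alpha>' \<and> \<alpha> f = v then {[]} else {})"
| "traces F V (Assign f v) \<alpha> \<alpha>' = (if \<alpha>' = \<alpha>(f := v) then {[]} else {})"
| "traces F V (PushP v) \<alpha> \<alpha>' = (if \<alpha> = \<alpha>' then {[Push v]} else {})"
| "traces F V (PopP v) \<alpha> \<alpha>' = (if \<alpha> = \<alpha>' then {[Pop v]} else {})"
  by pat_completeness auto
termination
  by (relation "measures [\<lambda>(F, V, e, \<alpha>, \<alpha>'). star_height e, \<lambda>(F, V, e, \<alpha>, \<alpha>'). size e]")
    (auto simp: less_Suc_eq_le star_height_rpow less_max_iff_disj)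

inductive_set pushpop :: "'v stackop list set \<Rightarrow> 'v stackop list set"
  for L :: "'v stackop list set" where
  base: "w \<in> L \<Longrightarrow> w \<in> pushpop L"
| cancel: "x @ [Push v, Pop v] @ y \<in> pushpop L \<Longrightarrow> x @ y \<in> pushpop L"

datatype 'v cell = Op "'v stackop" | Done

text \<open>
  \<open>zips w z\<close> is the graph of the partial function zip, one rule per defining equation. Lemmas
  \<open>zips_functional\<close> and \<open>zips_defined_iff\<close> confirm that it is a partial function with the
  intended domain. The first letter of \<open>z\<close> is the innermost pair of \<open>w\<close>, which concerns the
  deepest stack position.
\<close>

inductive zips :: "'v stackop list \<Rightarrow> ('v cell \<times> 'v cell) list \<Rightarrow> bool" where
  nil: "zips [] []"
| both: "x \<in> lists (range Pop) \<Longrightarrow> y \<in> lists (range Push) \<Longrightarrow> zips (x @ y) z \<Longrightarrow>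
    zips (x @ [Pop v, Push w] @ y) ((Op (Pop v), Op (Push w)) # z)"
| pop: "x \<in> lists (range Pop) \<Longrightarrow> zips x z \<Longrightarrow> zips (x @ [Pop v]) ((Op (Pop v), Done) # z)"
| push: "y \<in> lists (range Push) \<Longrightarrow> zips y z \<Longrightarrow> zips (Push v # y) ((Done, Op (Push v)) # z)"

fun zip_words :: "'v list \<Rightarrow> 'v list \<Rightarrow> ('v cell \<times> 'v cell) list" where
  "zip_words [] [] = []"
| "zip_words (v # p) (w # q) = (Op (Pop v), Op (Push w)) # zip_words p q"
| "zip_words (v # p) [] = (Op (Pop v), Done) # zip_words p []"
| "zip_words [] (w # q) = (Done, Op (Push w)) # zip_words [] q"

lemma in_lists_range: "x \<in> lists (range f) \<longleftrightarrow> (\<exists>p. x = map f p)"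
  by (induction x) (auto simp: Cons_eq_map_conv)

lemma map_Pop_Push_inject:
  "map Pop p @ map Push q = map Pop p' @ map Push q' \<longleftrightarrow> p = p' \<and> q = q'"
proof (induction p arbitrary: p')
  case Nil
  show ?case
    by (cases p'; cases q) (auto simp: map_eq_Cons_conv inj_map_eq_map inj_def)
next
  case (Cons a p)
  then show ?case
    by (cases p'; cases q') auto
qed

lemma zips_zip_words: "zips (map Pop (rev p) @ map Push q) (zip_words p q)"
proof (induction p q rule: zip_words.induct)
  case (2 v p w q)
  then show ?case using both[of "map Pop (rev p)" "map Push q"] by (auto simp: in_lists_range)
next
  case (3 v p)
  then show ?case using pop[of "map Pop (rev p)"] by (auto simp: in_lists_range)
next
  case (4 w q)
  then show ?case using push[of "map Push q"] by (auto simp: in_lists_range)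
qed (simp add: nil)

lemma zips_imp_zip_words:
  "zips w z \<Longrightarrow> \<exists>p q. w = map Pop (rev p) @ map Push q \<and> z = zip_words p q"
proof (induction rule: zips.induct)
  case nil
  show ?case by (intro exI[of _ "[]"]) simp
next
  case (both x y z v w)
  from both(1,2) obtain p q where xy: "x = map Pop p" "y = map Push q"
    by (auto simp: in_lists_range)
  from both(4) obtain p' q' where "x @ y = map Pop (rev p') @ map Push q'" "z = zip_words p' q'"
    by blast
  with xy show ?case
    by (intro exI[of _ "v # p'"] exI[of _ "w # q'"]) (simp add: map_Pop_Push_inject)
next
  case (pop x z v)
  from pop(1) obtain p where x: "x = map Pop p"
    by (auto simp: in_lists_range)
  from pop(3) obtain p' q' where "x = map Pop (rev p') @ map Push q'" "z = zip_words p' q'"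
    by blast
  with x show ?case
    using map_Pop_Push_inject[of p "[]" "rev p'" q']
    by (intro exI[of _ "v # p'"] exI[of _ "[]"]) simp
next
  case (push y z v)
  from push(1) obtain q where y: "y = map Push q"
    by (auto simp: in_lists_range)
  from push(3) obtain p' q' where "y = map Pop (rev p') @ map Push q'" "z = zip_words p' q'"
    by blast
  with y show ?case
    using map_Pop_Push_inject[of "[]" q "rev p'" q']
    by (intro exI[of _ "[]"] exI[of _ "v # q'"]) simp
qed

lemma zips_functional: "zips w z \<Longrightarrow> zips w z' \<Longrightarrow> z = z'"
  by (auto dest!: zips_imp_zip_words simp: map_Pop_Push_inject)

lemma zips_defined_iff:
  "(\<exists>z. zips w z) \<longleftrightarrow> (\<exists>x\<in>lists (range Pop). \<exists>y\<in>lists (range Push). w = x @ y)"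
  by (metis in_lists_range rev_rev_ident zips_imp_zip_words zips_zip_words)

definition zip_lang :: "'v stackop list set \<Rightarrow> ('v cell \<times> 'v cell) list set" where
  "zip_lang L = {z. \<exists>w\<in>L. zips w z}"

definition diag :: "'v set \<Rightarrow> ('v cell \<times> 'v cell) set" where
  "diag V = {(Op (Pop v), Op (Push v)) | v. v \<in> V}"

text \<open>The canonical traces; \<open>lists (diag V)\<close> is the Kleene star of the alphabet \<open>diag V\<close>.\<close>

definition ctraces ::
  "'f set \<Rightarrow> 'v set \<Rightarrow> ('f, 'v) prog \<Rightarrow> ('f \<Rightarrow> 'v) \<Rightarrow> ('f \<Rightarrow> 'v) \<Rightarrow> ('v cell \<times> 'v cell) list set" where
  "ctraces F V e \<alpha>\<^sub>1 \<alpha>\<^sub>2 =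
     {a @ z | a z. a \<in> lists (diag V) \<and> z \<in> zip_lang (pushpop (traces F V e \<alpha>\<^sub>1 \<alpha>\<^sub>2))}"

end

theory Submission
  imports Defs
begin

text \<open>
  Reading a trace as a partial transformation of stacks, the semantics of a program relates
  \<open>(\<alpha>, s)\<close> to \<open>(\<alpha>', s')\<close> iff some trace from \<open>\<alpha>\<close> to \<open>\<alpha>'\<close> transforms \<open>s\<close> into \<open>s'\<close>. Cancelling
  a factor push-pop does not change this transformation, and a trace with nonempty domain can
  be cancelled to pops followed by pushes; such a normal trace replaces a fixed top segment by
  another one and leaves an arbitrary rest untouched. Prefixing by letters of the diagonal
  alphabet adds exactly this rest, so a canonical trace is nothing but an encoding, by the
  injective map \<open>zip_words\<close>, of a pair of whole stacks (read from the bottom) related by the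
  semantics.
\<close>

section \<open>Words of stack operations as partial maps on stacks, and cancellation\<close>

primrec step :: "'v stackop \<Rightarrow> 'v list rel" where
  "step (Push v) = {(s, v # s) | s. True}"
| "step (Pop v) = {(v # s, s) | s. True}"

primrec exec :: "'v stackop list \<Rightarrow> 'v list rel" where
  "exec [] = Id"
| "exec (a # w) = step a O exec w"

lemma exec_append: "exec (u @ w) = exec u O exec w"
  by (induction u) (auto simp: O_assoc)

lemma exec_Push_Pop: "exec [Push v, Pop v] = Id"
  by auto

lemma exec_pops: "exec (map Pop p) = {(p @ t, t) | t. True}"
  by (induction p) auto

lemma exec_pushes: "exec (map Push q) = {(t, rev q @ t) | t. True}"
  by (induction q) auto

lemma exec_normal:
  "exec (map Pop (rev p) @ map Push q) = {(rev p @ t, rev q @ t) | t. True}"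
  by (auto simp: exec_append exec_pops exec_pushes)

text \<open>Soundness of cancellation: a push followed by the matching pop is the total identity, so
  undoing the \<open>cancel\<close> steps leads back to a word of \<open>L\<close> with the same
  effect. The opposite order would give only a partial identity.\<close>

lemma exec_pushpop: "w \<in> pushpop L \<Longrightarrow> \<exists>u\<in>L. exec u = exec w"
proof (induction rule: pushpop.induct)
  case (cancel x v y)
  have "exec (x @ [Push v, Pop v] @ y) = exec (x @ y)"
    by (simp only: exec_append exec_Push_Pop Id_O_R)
  with cancel.IH show ?case
    by simp
qed auto

text \<open>The suffix \<open>y\<close> is not yet normalised: induction on \<open>w\<close> moves its last letter there.\<close>

lemma pushpop_normalize_prefix:
  assumes "w @ y \<in> pushpop L" and "(s, s') \<in> exec w"
  shows "\<exists>p q. (map Pop (rev p) @ map Push q) @ y \<in> pushpop L \<and>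
    (s, s') \<in> exec (map Pop (rev p) @ map Push q)"
  using assms
proof (induction w arbitrary: y s' rule: rev_induct)
  case Nil
  then show ?case
    by (intro exI[of _ "[]"]) simp
next
  case (snoc a w)
  from snoc.prems(2) obtain r where r: "(s, r) \<in> exec w" "(r, s') \<in> step a"
    by (auto simp: exec_append)
  from snoc.IH[OF _ r(1), of "a # y"] snoc.prems(1) obtain p q where
    pq: "(map Pop (rev p) @ map Push q) @ a # y \<in> pushpop L"
      "(s, r) \<in> exec (map Pop (rev p) @ map Push q)"
    by auto
  from pq(2) obtain t where t: "s = rev p @ t" "r = rev q @ t"
    by (auto simp: exec_normal)
  show ?case
  proof (cases a)
    case (Push v)
    with pq t r(2) show ?thesis
      by - (rule exI[of _ p], rule exI[of _ "q @ [v]"], simp add: exec_append exec_pops exec_pushes relcomp_unfold)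
  next
    case (Pop v)
    show ?thesis
    \<comment> \<open>With no push to undo, the pop consumes the head of the rest \<open>t\<close>
      and joins the pops as their last letter, hence \<open>v # p\<close>. Otherwise it succeeds
      only on the value pushed last, and the two letters cancel.\<close>
    proof (cases q rule: rev_exhaust)
      case Nil
      with Pop pq t r(2) show ?thesis
        by - (rule exI[of _ "v # p"], rule exI[of _ "[]"], simp add: exec_append exec_pops relcomp_unfold)
    next
      case (snoc q' u)
      with Pop t r(2) have "u = v" "s' = rev q' @ t"
        by auto
      moreover from this have "(map Pop (rev p) @ map Push q') @ y \<in> pushpop L"
        using pushpop.cancel[of "map Pop (rev p) @ map Push q'" v y L] pq(1) snoc Pop by simp
      ultimately show ?thesis
        using t by - (rule exI[of _ p], rule exI[of _ q'], simp add: exec_normal)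
    qed
  qed
qed

text \<open>Normalization with empty suffix gives one direction, soundness of cancellation the
  other; \<open>t\<close> is the rest of the stack that the normal trace leaves untouched.\<close>

lemma exec_iff_pushpop:
  "(\<exists>w\<in>L. (s, s') \<in> exec w) \<longleftrightarrow>
    (\<exists>p q t. map Pop (rev p) @ map Push q \<in> pushpop L \<and> s = rev p @ t \<and> s' = rev q @ t)"
proof
  assume "\<exists>w\<in>L. (s, s') \<in> exec w"
  then obtain w where "w \<in> L" "(s, s') \<in> exec w"
    by blast
  with pushpop_normalize_prefix[of w "[]" L s s'] pushpop.base[of w L]
  obtain p q where "map Pop (rev p) @ map Push q \<in> pushpop L"
    "(s, s') \<in> exec (map Pop (rev p) @ map Push q)"
    by auto
  then show "\<exists>p q t. map Pop (rev p) @ map Push q \<in> pushpop L \<and> s = rev p @ t \<and> s' = rev q @ t"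
    unfolding exec_normal by blast
next
  assume "\<exists>p q t. map Pop (rev p) @ map Push q \<in> pushpop L \<and> s = rev p @ t \<and> s' = rev q @ t"
  then obtain p q where pq: "map Pop (rev p) @ map Push q \<in> pushpop L"
    "(s, s') \<in> exec (map Pop (rev p) @ map Push q)"
    unfolding exec_normal by blast
  from exec_pushpop[OF pq(1)] pq(2) show "\<exists>w\<in>L. (s, s') \<in> exec w"
    by auto
qed

section \<open>Letters of traces, and agreement of traces with the semantics\<close>

lemma pushpop_lists: "L \<subseteq> lists A \<Longrightarrow> pushpop L \<subseteq> lists A"
proof
  fix w assume "L \<subseteq> lists A" and "w \<in> pushpop L"
  from this(2,1) show "w \<in> lists A"
    by (induction rule: pushpop.induct) auto
qed

text \<open>Since \<open>exec\<close> acts on arbitrary stacks, the carrier \<open>V\<close> enters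
  here: the values popped by a trace lie in \<open>V\<close>, so the stacks reassembled from
  canonical traces do too.\<close>

lemma traces_letters:
  "w \<in> traces F V e \<alpha> \<alpha>' \<Longrightarrow> (\<Union>a\<in>set w. set_stackop a) \<subseteq> vals_of e"
proof (induction e arbitrary: \<alpha> \<alpha>' w)
  case (Plus e1 e2)
  then show ?case
    by (simp add: le_supI1 le_supI2) blast
next
  case (Seq e1 e2)
  from Seq.prems obtain \<beta> w1 w2 where w: "w = w1 @ w2"
    "w1 \<in> traces F V e1 \<alpha> \<beta>" "w2 \<in> traces F V e2 \<beta> \<alpha>'"
    by auto
  with Seq.IH(1)[OF w(2)] Seq.IH(2)[OF w(3)] show ?case
    by auto
next
  case (Star e)
  have "u \<in> traces F V (rpow e n) \<alpha> \<alpha>' \<Longrightarrow> (\<Union>a\<in>set u. set_stackop a) \<subseteq> vals_of e" for n \<alpha>' u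
  proof (induction n arbitrary: \<alpha>' u)
    case (Suc n)
    then obtain \<beta> w1 w2 where w: "u = w1 @ w2"
      "w1 \<in> traces F V (rpow e n) \<alpha> \<beta>" "w2 \<in> traces F V e \<beta> \<alpha>'"
      by auto
    with Suc.IH[OF w(2)] Star.IH[OF w(3)] show ?case
      by auto
  qed (simp split: if_splits)
  moreover from Star.prems obtain n where "w \<in> traces F V (rpow e n) \<alpha> \<alpha>'"
    by auto
  ultimately show ?case
    by simp
qed (auto split: if_splits)

text \<open>Reconciles the two unfoldings of star: the powers of a relation commute with it.
  Membership in \<open>programs F V\<close> makes \<open>Id_on (packets F V)\<close> neutral for
  composition.\<close>

lemma sem_rpow: "sem F V (rpow e n) = sem F V (lpow e n)"
  if "e \<in> programs F V"
proof -
  have Id: "R O Id_on (packets F V) = R" "Id_on (packets F V) O R = R"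
    if "R \<subseteq> packets F V \<times> packets F V" for R
    using that by auto
  have comm: "sem F V (lpow e n) O sem F V e = sem F V e O sem F V (lpow e n)" for n
    by (induction n) (simp_all add: Id sem_subset_packets[OF that] O_assoc)
  show ?thesis
    by (induction n) (simp_all add: comm)
qed

lemma rpow_programs: "e \<in> programs F V \<Longrightarrow> rpow e n \<in> programs F V"
  by (induction n) (auto simp: programs_def)

text \<open>Kept apart from the structural induction because it serves twice: for
  \<open>Seq\<close>, and for the powers \<open>rpow e n\<close>, which are not subterms of
  \<open>Star e\<close> and need their own induction on \<open>n\<close>.\<close>

lemma sem_iff_traces_Seq:
  assumes e1: "e1 \<in> programs F V"
    and iff1: "\<And>\<alpha> s \<alpha>' s'. ((\<alpha>, s), (\<alpha>', s')) \<in> sem F V e1 \<longleftrightarrow>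
      \<alpha> \<in> headers F V \<and> \<alpha>' \<in> headers F V \<and> s \<in> lists V \<and>
      (\<exists>w\<in>traces F V e1 \<alpha> \<alpha>'. (s, s') \<in> exec w)"
    and iff2: "\<And>\<alpha> s \<alpha>' s'. ((\<alpha>, s), (\<alpha>', s')) \<in> sem F V e2 \<longleftrightarrow>
      \<alpha> \<in> headers F V \<and> \<alpha>' \<in> headers F V \<and> s \<in> lists V \<and>
      (\<exists>w\<in>traces F V e2 \<alpha> \<alpha>'. (s, s') \<in> exec w)"
  shows "((\<alpha>, s), (\<alpha>', s')) \<in> sem F V (Seq e1 e2) \<longleftrightarrow>
    \<alpha> \<in> headers F V \<and> \<alpha>' \<in> headers F V \<and> s \<in> lists V \<and>
    (\<exists>w\<in>traces F V (Seq e1 e2) \<alpha> \<alpha>'. (s, s') \<in> exec w)"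
    (is "?lhs \<longleftrightarrow> ?rhs")
proof
  assume ?lhs
  then obtain \<beta> r where "((\<alpha>, s), (\<beta>, r)) \<in> sem F V e1" "((\<beta>, r), (\<alpha>', s')) \<in> sem F V e2"
    by auto
  then obtain w1 w2 where "\<alpha> \<in> headers F V" "\<beta> \<in> headers F V" "\<alpha>' \<in> headers F V" "s \<in> lists V"
    "w1 \<in> traces F V e1 \<alpha> \<beta>" "(s, r) \<in> exec w1" "w2 \<in> traces F V e2 \<beta> \<alpha>'" "(r, s') \<in> exec w2"
    unfolding iff1 iff2 by blast
  moreover from this have "w1 @ w2 \<in> traces F V (Seq e1 e2) \<alpha> \<alpha>'" "(s, s') \<in> exec (w1 @ w2)"
    by (auto simp: exec_append)
  ultimately show ?rhs
    by blast
next
  assume R: ?rhs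
  then obtain \<beta> w1 w2 r where \<beta>: "\<beta> \<in> headers F V"
    and w: "w1 \<in> traces F V e1 \<alpha> \<beta>" "(s, r) \<in> exec w1" "w2 \<in> traces F V e2 \<beta> \<alpha>'" "(r, s') \<in> exec w2"
    by (auto simp: exec_append)
  with R have 1: "((\<alpha>, s), (\<beta>, r)) \<in> sem F V e1"
    unfolding iff1 by blast
  \<comment> \<open>\<open>iff2\<close> demands an intermediate stack over \<open>V\<close>; the
    semantics of \<open>e1\<close> supplies it by staying within the packets.\<close>
  then have "r \<in> lists V"
    using sem_subset_packets[OF e1] by (auto simp: packets_def)
  with \<beta> w R have "((\<beta>, r), (\<alpha>', s')) \<in> sem F V e2"
    unfolding iff2 by blast
  with 1 show ?lhs
    by auto
qed

lemma sem_iff_traces: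
  assumes "e \<in> programs F V"
  shows "((\<alpha>, s), (\<alpha>', s')) \<in> sem F V e \<longleftrightarrow>
    \<alpha> \<in> headers F V \<and> \<alpha>' \<in> headers F V \<and> s \<in> lists V \<and>
    (\<exists>w\<in>traces F V e \<alpha> \<alpha>'. (s, s') \<in> exec w)"
  using assms
proof (induction e arbitrary: \<alpha> s \<alpha>' s')
  case (Plus e1 e2)
  then show ?case
    by (auto simp: programs_def)
next
  case (Seq e1 e2)
  then show ?case
    by (intro sem_iff_traces_Seq) (auto simp: programs_def)
next
  case (Star e)
  then have e: "e \<in> programs F V"
    by (simp add: programs_def)
  have "((\<alpha>, s), (\<alpha>', s')) \<in> sem F V (rpow e n) \<longleftrightarrow>
    \<alpha> \<in> headers F V \<and> \<alpha>' \<in> headers F V \<and> s \<in> lists V \<and>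
    (\<exists>w\<in>traces F V (rpow e n) \<alpha> \<alpha>'. (s, s') \<in> exec w)" for n
  proof (induction n arbitrary: \<alpha> s \<alpha>' s')
    case 0
    then show ?case
      by (auto simp: packets_def)
  next
    case (Suc n)
    show ?case
      unfolding rpow.simps
      by (rule sem_iff_traces_Seq[OF rpow_programs[OF e] Suc Star.IH[OF e]])
  qed
  then show ?case
    by (auto simp: sem_rpow[OF e, symmetric])
qed (auto simp: programs_def packets_def headers_update split: if_splits)

section \<open>Canonical traces as encoded pairs of stacks\<close>

text \<open>Each cell shows its letter or \<open>Done\<close> on either side, so both words,
  including their lengths, can be read off.\<close>

lemma zip_words_inject: "zip_words p q = zip_words p' q' \<longleftrightarrow> p = p' \<and> q = q'"
proof (induction p q arbitrary: p' q' rule: zip_words.induct)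
  case 1
  show ?case by (cases "(p', q')" rule: zip_words.cases) auto
next
  case (2 v p w q)
  then show ?case by (cases "(p', q')" rule: zip_words.cases) auto
next
  case (3 v p)
  then show ?case by (cases "(p', q')" rule: zip_words.cases) auto
next
  case (4 w q)
  then show ?case by (cases "(p', q')" rule: zip_words.cases) auto
qed

text \<open>Turns the diagonal prefix of a canonical trace into a common bottom segment of two
  stacks.\<close>

lemma zip_words_append_same:
  "zip_words (a @ p) (a @ q) = map (\<lambda>v. (Op (Pop v), Op (Push v))) a @ zip_words p q"
  by (induction a) auto

lemma lists_diag: "lists (diag V) = map (\<lambda>v. (Op (Pop v), Op (Push v))) ` lists V"
  by (simp add: diag_def lists_image[symmetric] setcompr_eq_image)

lemma zip_lang_eq: "zip_lang L = {zip_words p q | p q. map Pop (rev p) @ map Push q \<in> L}"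
  unfolding zip_lang_def using zips_zip_words by (blast dest: zips_imp_zip_words)

text \<open>The diagonal prefix spells \<open>a\<close>, read from the bottom; as stacks have their
  top at the head, it is the reversal of the untouched rest \<open>t\<close> in
  \<open>exec_iff_pushpop\<close>.\<close>

lemma ctraces_eq_sem:
  assumes e: "e \<in> programs F V" and "\<alpha> \<in> headers F V" "\<alpha>' \<in> headers F V"
  shows "ctraces F V e \<alpha> \<alpha>' =
    {zip_words (rev s) (rev s') | s s'. ((\<alpha>, s), (\<alpha>', s')) \<in> sem F V e}"
proof -
  let ?T = "pushpop (traces F V e \<alpha> \<alpha>')"
  have letters: "?T \<subseteq> lists {a. set_stackop a \<subseteq> V}"
    using traces_letters[of _ F V e \<alpha> \<alpha>'] e
    by (intro pushpop_lists) (fastforce simp: programs_def)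
  have pops: "p \<in> lists V" if "map Pop (rev p) @ map Push q \<in> ?T" for p q
    using subsetD[OF letters that] by auto
  have "ctraces F V e \<alpha> \<alpha>' =
    {zip_words (a @ p) (a @ q) | a p q. a \<in> lists V \<and> map Pop (rev p) @ map Push q \<in> ?T}"
    unfolding ctraces_def zip_lang_eq lists_diag zip_words_append_same by blast
  also have "\<dots> = {zip_words (rev s) (rev s') | s s'. s \<in> lists V \<and>
    (\<exists>p q t. map Pop (rev p) @ map Push q \<in> ?T \<and> s = rev p @ t \<and> s' = rev q @ t)}"
    (is "?A = ?B")
  proof
    show "?A \<subseteq> ?B"
    proof
      fix z assume "z \<in> ?A"
      then obtain a p q where z: "z = zip_words (a @ p) (a @ q)" "a \<in> lists V"
        "map Pop (rev p) @ map Push q \<in> ?T"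
        by blast
      with pops[OF z(3)] show "z \<in> ?B"
        by - (rule CollectI, rule exI[of _ "rev p @ rev a"], rule exI[of _ "rev q @ rev a"], auto)
    qed
    show "?B \<subseteq> ?A"
    proof
      fix z assume "z \<in> ?B"
      then obtain p q t where z: "z = zip_words (rev (rev p @ t)) (rev (rev q @ t))"
        "rev p @ t \<in> lists V" "map Pop (rev p) @ map Push q \<in> ?T"
        by blast
      then show "z \<in> ?A"
        by - (rule CollectI, rule exI[of _ "rev t"], rule exI[of _ p], rule exI[of _ q], auto)
    qed
  qed
  also have "\<dots> = {zip_words (rev s) (rev s') | s s'. ((\<alpha>, s), (\<alpha>', s')) \<in> sem F V e}"
    using assms(2,3) by (simp only: sem_iff_traces[OF e] exec_iff_pushpop simp_thms)
  finally show ?thesis .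
qed

theorem theorem4p2:
  fixes F :: "'f set" and V :: "nat set" and e1 e2 :: "('f, nat) prog"
  assumes "finite F" and "finite V"
    and "e1 \<in> programs F V" and "e2 \<in> programs F V"
  shows "(\<forall>\<alpha>\<^sub>1\<in>headers F V. \<forall>\<alpha>\<^sub>2\<in>headers F V. ctraces F V e1 \<alpha>\<^sub>1 \<alpha>\<^sub>2 = ctraces F V e2 \<alpha>\<^sub>1 \<alpha>\<^sub>2)
    \<longleftrightarrow> sem F V e1 = sem F V e2"
proof
  assume eq: "\<forall>\<alpha>\<^sub>1\<in>headers F V. \<forall>\<alpha>\<^sub>2\<in>headers F V. ctraces F V e1 \<alpha>\<^sub>1 \<alpha>\<^sub>2 = ctraces F V e2 \<alpha>\<^sub>1 \<alpha>\<^sub>2"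
  \<comment> \<open>Injectivity of the encoding lets the semantics be read back from
    \<open>ctraces\<close>. The header conditions confine this to the pairs of headers that
    \<open>eq\<close> covers.\<close>
  have sem_iff: "((\<alpha>, s), (\<alpha>', s')) \<in> sem F V e \<longleftrightarrow> \<alpha> \<in> headers F V \<and> \<alpha>' \<in> headers F V \<and>
    zip_words (rev s) (rev s') \<in> ctraces F V e \<alpha> \<alpha>'"
    if e: "e \<in> programs F V" for e :: "('f, nat) prog" and \<alpha> \<alpha>' s s'
  proof -
    have "((\<alpha>, s), (\<alpha>', s')) \<in> sem F V e \<Longrightarrow> \<alpha> \<in> headers F V \<and> \<alpha>' \<in> headers F V"
      using sem_iff_traces[OF e] by blast
    then show ?thesis
      by (auto simp: ctraces_eq_sem[OF e] zip_words_inject)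
  qed
  show "sem F V e1 = sem F V e2"
    using eq by (auto simp: sem_iff assms(3,4))
next
  assume "sem F V e1 = sem F V e2"
  then show "\<forall>\<alpha>\<^sub>1\<in>headers F V. \<forall>\<alpha>\<^sub>2\<in>headers F V. ctraces F V e1 \<alpha>\<^sub>1 \<alpha>\<^sub>2 = ctraces F V e2 \<alpha>\<^sub>1 \<alpha>\<^sub>2"
    by (simp add: ctraces_eq_sem assms(3,4))
qed

end
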